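(* Let $G/K$ be a compact homogeneous space of dimension $n$; all spaces below are on $G/K$, and $r\in\mathbb{R}$ is arbitrary. Then: (1) $F_{p,q_1}^{r+\varepsilon}\hookrightarrow F_{p,q_1}^{r}\hookrightarrow F_{p,q_2}^{r}\hookrightarrow F_{p,\infty}^{r}$ for $\varepsilon>0$, $0<p\leq\infty$, $0<q_1\le q_2\le \infty$; (2) $F_{p,q_1}^{r+\varepsilon}\hookrightarrow F_{p,q_2}^{r}$ for $\varepsilon>0$, $0<p\leq\infty$, $1\leq q_2<q_1<\infty$; (3) $F_{p,p}^{r}=B_{p,p}^{r}$ for $0<p<\infty$; (4) $B_{p,\min\{p,q\}}^{r}\hookrightarrow F_{p,q}^{r}\hookrightarrow B_{p,\max\{p,q\}}^{r}$ for $0<p<\infty$, $0<q\le\infty$.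
   Context: Setting. $G$ is a compact Lie group, $K$ a closed subgroup, $n=\dim G/K$. All Haar measures are normalised to total mass one, and $G/K$ carries the corresponding normalised invariant measure; functions and distributions on $G/K$ are identified with their liftings $\widetilde f(g)=f(gK)$ to $G$. $\widehat G$ is the unitary dual of $G$; each class is represented by a unitary matrix representation $\xi:G\to\mathbb{C}^{d_\xi\times d_\xi}$. $\widehat{G}_0\subset\widehat G$ is the set of class I representations (those having a non-zero $K$-invariant vector); $k_\xi$ is the dimension of the space of $K$-invariant vectors of $\xi$, and the orthonormal basis of the representation space is chosen so that its first $k_\xi$ vectors span this space. Fourier coefficients: $\widehat f(\xi)=\int_G f(x)\xi(x)^*\,dx$ (extended to distributions). For $f\in\mathcal{D}'(G/K)$ one has $\widehat f(\xi)=0$ if $[\xi]\notin\widehat G_0$ and $\widehat f(\xi)_{ij}=0$ for $i>k_\xi$; by convention $\xi(x)_{ij}:=0$ for $j>k_\xi$, and the Fourier series is $f(x)=\sum_{[\xi]\in\widehat G_0}d_\xi\,\mathrm{Tr}(\widehat f(\xi)\xi(x))$. $\mathcal{L}_{G/K}$ is the operator on $G/K$ induced by the Laplace–Beltrami operator (Casimir element) $\mathcal{L}_G$ of $G$, i.e. $\widetilde{\mathcal{L}_{G/K}f}=\mathcal{L}_G\widetilde f$; for $[\xi]\in\widehat G_0$, $\langle\xi\rangle\ge1$ is the eigenvalue of $(1-\mathcal{L}_{G/K})^{1/2}$ on the functions $\xi_{ij}$, $1\le i\le d_\xi$, $1\le j\le k_\xi$. For $f\in\mathcal{D}'(G/K)$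 write $f_s(x)=\sum_{2^{s}\le\langle\xi\rangle<2^{s+1}} d_\xi\,\mathrm{Tr}(\widehat f(\xi)\xi(x))$, $s=0,1,2,\dots$. For $r\in\mathbb{R}$ and $0<p,q\le\infty$, the Besov space $B^r_{p,q}=B^r_{p,q}(G/K)$ is the set of $f\in\mathcal{D}'(G/K)$ with $$\|f\|_{B^{r}_{p,q}} :=\left(\sum_{s=0}^\infty 2^{sr q} \|f_s\|_{L^p(G/K)}^q\right)^{1/q}<\infty,$$ and the Triebel–Lizorkin space $F^r_{p,q}=F^r_{p,q}(G/K)$ is the set of $f\in\mathcal{D}'(G/K)$ with $$\|f\|_{F^{r}_{p,q}} :=\left\|\left(\sum_{s=0}^\infty 2^{sr q}|f_s(x)|^q\right)^{1/q}\right\|_{L^p(G/K)}<\infty,$$ with the usual modification (supremum over $s$) when $q=\infty$. The symbol $\hookrightarrow$ denotes continuous embedding, and equality of spaces is with equivalence of norms. *)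

theory Defs
  imports
    "HOL-Analysis.Analysis"
    "HOL-Probability.Essential_Supremum"
    "HOL-Library.Function_Algebras"
    "HOL-Algebra.Left_Coset"
    "Jordan_Normal_Form.Schur_Decomposition"
begin

section \<open>Smooth manifolds of arbitrary dimension\<close>

text \<open>Charts take values in \<^const>\<open>Euclidean_space\<close> \<open>m\<close>, the space of sequences that vanish from
  index \<open>m\<close> on, so that the dimension is a natural number (and may be \<open>0\<close>).\<close>

definition coord_deriv ::
    "nat \<Rightarrow> ((nat \<Rightarrow> real) \<Rightarrow> 'b::real_normed_vector) \<Rightarrow> (nat \<Rightarrow> real) \<Rightarrow> 'b" where
  "coord_deriv i f x = vector_derivative (\<lambda>t. f (x(i := t))) (at (x i))"

definition smooth_coord ::
    "nat \<Rightarrow> (nat \<Rightarrow> real) set \<Rightarrow> ((nat \<Rightarrow> real) \<Rightarrow> 'b::real_normed_vector) \<Rightarrow> bool" where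
  "smooth_coord m U f \<longleftrightarrow>
     (\<forall>is. set is \<subseteq> {..<m} \<longrightarrow>
        continuous_map (subtopology (Euclidean_space m) U) euclidean (foldr coord_deriv is f) \<and>
        (\<forall>i<m. \<forall>x\<in>U. (\<lambda>t. foldr coord_deriv is f (x(i := t))) differentiable (at (x i))))"

type_synonym 'a chart = "'a set \<times> ('a \<Rightarrow> nat \<Rightarrow> real)"

definition smooth_manifold :: "'a topology \<Rightarrow> nat \<Rightarrow> 'a chart set \<Rightarrow> bool" where
  "smooth_manifold T m A \<longleftrightarrow>
     Hausdorff_space T \<and> second_countable T \<and>
     (\<Union>(U, \<phi>)\<in>A. U) = topspace T \<and>
     (\<forall>(U, \<phi>)\<in>A. openin T U \<and> openin (Euclidean_space m) (\<phi> ` U) \<and>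
        homeomorphic_map (subtopology T U) (subtopology (Euclidean_space m) (\<phi> ` U)) \<phi>) \<and>
     (\<forall>(U, \<phi>)\<in>A. \<forall>(V, \<psi>)\<in>A. \<forall>i<m.
        smooth_coord m (\<phi> ` (U \<inter> V)) (\<lambda>z. \<psi> (inv_into U \<phi> z) i))"

definition smooth_map ::
    "'a topology \<Rightarrow> nat \<Rightarrow> 'a chart set \<Rightarrow> 'b topology \<Rightarrow> nat \<Rightarrow> 'b chart set \<Rightarrow> ('a \<Rightarrow> 'b) \<Rightarrow> bool" where
  "smooth_map T m A T' m' A' f \<longleftrightarrow>
     continuous_map T T' f \<and>
     (\<forall>(U, \<phi>)\<in>A. \<forall>(V, \<psi>)\<in>A'. \<forall>i<m'.
        smooth_coord m (\<phi> ` (U \<inter> f -` V)) (\<lambda>z. \<psi> (f (inv_into U \<phi> z)) i))"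

definition prod_atlas :: "nat \<Rightarrow> 'a chart set \<Rightarrow> nat \<Rightarrow> 'b chart set \<Rightarrow> ('a \<times> 'b) chart set" where
  "prod_atlas m A m' A' =
     {(U \<times> V, \<lambda>(x, y) i. if i < m then \<phi> x i else if i < m + m' then \<psi> y (i - m) else 0) | U \<phi> V \<psi>.
        (U, \<phi>) \<in> A \<and> (V, \<psi>) \<in> A'}"


section \<open>Compact Lie groups\<close>

record 'a lie_group = "'a monoid" +
  lie_top :: "'a topology"
  lie_dim :: nat
  lie_atlas :: "'a chart set"

definition compact_lie_group :: "('a, 'm) lie_group_scheme \<Rightarrow> bool" where
  "compact_lie_group G \<longleftrightarrow>
     group G \<and> topspace (lie_top G) = carrier G \<and> compact_space (lie_top G) \<and>
     smooth_manifold (lie_top G) (lie_dim G) (lie_atlas G) \<and>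
     smooth_map (prod_topology (lie_top G) (lie_top G)) (lie_dim G + lie_dim G)
       (prod_atlas (lie_dim G) (lie_atlas G) (lie_dim G) (lie_atlas G))
       (lie_top G) (lie_dim G) (lie_atlas G) (\<lambda>(x, y). x \<otimes>\<^bsub>G\<^esub> y) \<and>
     smooth_map (lie_top G) (lie_dim G) (lie_atlas G) (lie_top G) (lie_dim G) (lie_atlas G)
       (\<lambda>x. inv\<^bsub>G\<^esub> x)"

definition borel_top :: "'a topology \<Rightarrow> 'a measure" where
  "borel_top T = sigma (topspace T) {U. openin T U}"

text \<open>On a compact metrisable group every Borel probability measure is regular, so the following
  determines \<open>\<mu>\<close> uniquely.\<close>

definition normalised_haar :: "('a, 'm) monoid_scheme \<Rightarrow> 'a topology \<Rightarrow> 'a measure \<Rightarrow> bool" where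
  "normalised_haar G T \<mu> \<longleftrightarrow>
     sets \<mu> = sets (borel_top T) \<and> emeasure \<mu> (space \<mu>) = 1 \<and>
     (\<forall>g\<in>carrier G. \<forall>A\<in>sets \<mu>. emeasure \<mu> (g <#\<^bsub>G\<^esub> A) = emeasure \<mu> A)"

text \<open>Functions on \<open>G\<close> (and later on \<open>G/K\<close>) are extended by \<open>0\<close> to the whole type, so that
  pointwise operations give honest algebras and vector spaces of functions.\<close>

definition on_carrier :: "('a, 'm) monoid_scheme \<Rightarrow> ('a \<Rightarrow> complex) \<Rightarrow> 'a \<Rightarrow> complex" where
  "on_carrier G f x = (if x \<in> carrier G then f x else 0)"

definition smooth_funs :: "('a, 'm) lie_group_scheme \<Rightarrow> ('a \<Rightarrow> complex) set" where
  "smooth_funs G =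
     {f. f = on_carrier G f \<and>
         (\<forall>(U, \<phi>)\<in>lie_atlas G. smooth_coord (lie_dim G) (\<phi> ` U) (\<lambda>z. f (inv_into U \<phi> z)))}"

type_synonym 'a fun_op = "('a \<Rightarrow> complex) \<Rightarrow> 'a \<Rightarrow> complex"

definition left_translate :: "('a, 'm) monoid_scheme \<Rightarrow> 'a \<Rightarrow> 'a fun_op" where
  "left_translate G g f = on_carrier G (\<lambda>x. f (g \<otimes>\<^bsub>G\<^esub> x))"

definition right_translate :: "('a, 'm) monoid_scheme \<Rightarrow> 'a \<Rightarrow> 'a fun_op" where
  "right_translate G g f = on_carrier G (\<lambda>x. f (x \<otimes>\<^bsub>G\<^esub> g))"

text \<open>The Lie algebra: real left-invariant vector fields, as derivations of the algebra of
  complex-valued smooth functions that commute with conjugation and with left translations.\<close>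

definition lie_algebra :: "('a, 'm) lie_group_scheme \<Rightarrow> 'a fun_op set" where
  "lie_algebra G =
     {X. (\<forall>f. f \<notin> smooth_funs G \<longrightarrow> X f = 0) \<and>
         (\<forall>f\<in>smooth_funs G. X f \<in> smooth_funs G \<and> X (cnj \<circ> f) = cnj \<circ> X f \<and>
            (\<forall>c. X (\<lambda>x. c * f x) = (\<lambda>x. c * X f x)) \<and>
            (\<forall>h\<in>smooth_funs G. X (f + h) = X f + X h \<and> X (f * h) = X f * h + f * X h) \<and>
            (\<forall>g\<in>carrier G. X (left_translate G g f) = left_translate G g (X f)))}"

definition op_scale :: "real \<Rightarrow> 'a fun_op \<Rightarrow> 'a fun_op" where
  "op_scale c X f = (\<lambda>x. of_real c * X f x)"

definition Ad :: "('a, 'm) lie_group_scheme \<Rightarrow> 'a \<Rightarrow> 'a fun_op \<Rightarrow> 'a fun_op" where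
  "Ad G g X f = (if f \<in> smooth_funs G
     then right_translate G g (X (right_translate G (inv\<^bsub>G\<^esub> g) f)) else 0)"

definition invariant_inner ::
    "('a, 'm) lie_group_scheme \<Rightarrow> ('a fun_op \<Rightarrow> 'a fun_op \<Rightarrow> real) \<Rightarrow> bool" where
  "invariant_inner G B \<longleftrightarrow>
     (\<forall>X\<in>lie_algebra G. \<forall>Y\<in>lie_algebra G.
        B X Y = B Y X \<and>
        (\<forall>Z\<in>lie_algebra G. B (X + Y) Z = B X Z + B Y Z) \<and>
        (\<forall>c. B (op_scale c X) Y = c * B X Y) \<and>
        (X \<noteq> 0 \<longrightarrow> B X X > 0) \<and>
        (\<forall>g\<in>carrier G. B (Ad G g X) (Ad G g Y) = B X Y))"

definition orthonormal_basis ::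
    "('a, 'm) lie_group_scheme \<Rightarrow> ('a fun_op \<Rightarrow> 'a fun_op \<Rightarrow> real) \<Rightarrow> 'a fun_op set \<Rightarrow> bool" where
  "orthonormal_basis G B E \<longleftrightarrow>
     finite E \<and> E \<subseteq> lie_algebra G \<and>
     (\<forall>X\<in>E. \<forall>Y\<in>E. B X Y = (if X = Y then 1 else 0)) \<and>
     Modules.module.span op_scale E = lie_algebra G"


section \<open>Unitary representations\<close>

type_synonym 'a matrep = "'a \<Rightarrow> complex mat"

definition rep_dim :: "('a, 'm) monoid_scheme \<Rightarrow> 'a matrep \<Rightarrow> nat" where
  "rep_dim G \<xi> = dim_row (\<xi> \<one>\<^bsub>G\<^esub>)"

definition unitary_rep :: "('a, 'm) lie_group_scheme \<Rightarrow> 'a matrep \<Rightarrow> bool" where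
  "unitary_rep G \<xi> \<longleftrightarrow>
     (\<forall>x\<in>carrier G. \<xi> x \<in> carrier_mat (rep_dim G \<xi>) (rep_dim G \<xi>) \<and>
        mat_adjoint (\<xi> x) * \<xi> x = 1\<^sub>m (rep_dim G \<xi>)) \<and>
     (\<forall>x\<in>carrier G. \<forall>y\<in>carrier G. \<xi> (x \<otimes>\<^bsub>G\<^esub> y) = \<xi> x * \<xi> y) \<and>
     (\<forall>i<rep_dim G \<xi>. \<forall>j<rep_dim G \<xi>. continuous_map (lie_top G) euclidean (\<lambda>x. \<xi> x $$ (i, j)))"

definition irreducible_rep :: "('a, 'm) lie_group_scheme \<Rightarrow> 'a matrep \<Rightarrow> bool" where
  "irreducible_rep G \<xi> \<longleftrightarrow>
     unitary_rep G \<xi> \<and> rep_dim G \<xi> > 0 \<and>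
     (\<forall>W. VectorSpace.subspace class_ring W (module_vec TYPE(complex) (rep_dim G \<xi>)) \<and>
          (\<forall>x\<in>carrier G. \<forall>v\<in>W. \<xi> x *\<^sub>v v \<in> W) \<longrightarrow>
        W = {0\<^sub>v (rep_dim G \<xi>)} \<or> W = carrier_vec (rep_dim G \<xi>))"

definition equivalent_reps :: "('a, 'm) lie_group_scheme \<Rightarrow> 'a matrep \<Rightarrow> 'a matrep \<Rightarrow> bool" where
  "equivalent_reps G \<xi> \<eta> \<longleftrightarrow>
     rep_dim G \<xi> = rep_dim G \<eta> \<and>
     (\<exists>P\<in>carrier_mat (rep_dim G \<xi>) (rep_dim G \<xi>).
        mat_adjoint P * P = 1\<^sub>m (rep_dim G \<xi>) \<and> (\<forall>x\<in>carrier G. P * \<xi> x = \<eta> x * P))"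

definition invariant_vecs :: "('a, 'm) monoid_scheme \<Rightarrow> 'a set \<Rightarrow> 'a matrep \<Rightarrow> complex vec set" where
  "invariant_vecs G K \<xi> = {v \<in> carrier_vec (rep_dim G \<xi>). \<forall>k\<in>K. \<xi> k *\<^sub>v v = v}"

definition inv_dim :: "('a, 'm) monoid_scheme \<Rightarrow> 'a set \<Rightarrow> 'a matrep \<Rightarrow> nat" where
  "inv_dim G K \<xi> =
     vectorspace.dim class_ring
       ((module_vec TYPE(complex) (rep_dim G \<xi>))\<lparr>carrier := invariant_vecs G K \<xi>\<rparr>)"

text \<open>A system \<open>R\<close> of representatives of the unitary dual, each written in an orthonormal basis
  whose first \<^const>\<open>inv_dim\<close> vectors span the \<open>K\<close>-invariant vectors.\<close>

definition unitary_dual :: "('a, 'm) lie_group_scheme \<Rightarrow> 'a set \<Rightarrow> 'a matrep set \<Rightarrow> bool" where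
  "unitary_dual G K R \<longleftrightarrow>
     (\<forall>\<xi>\<in>R. irreducible_rep G \<xi> \<and>
        LinearCombinations.module.span class_ring (module_vec TYPE(complex) (rep_dim G \<xi>))
          {unit_vec (rep_dim G \<xi>) i | i. i < inv_dim G K \<xi>} = invariant_vecs G K \<xi>) \<and>
     (\<forall>\<eta>. irreducible_rep G \<eta> \<longrightarrow> (\<exists>!\<xi>. \<xi> \<in> R \<and> equivalent_reps G \<eta> \<xi>))"


section \<open>Compact homogeneous spaces\<close>

text \<open>A homogeneous space \<open>G/K\<close> together with the auxiliary data of the harmonic analysis on it:
  the Haar measures of \<open>G\<close> and \<open>K\<close>, an orthonormal basis of the Lie algebra for an
  \<open>Ad\<close>-invariant inner product (i.e. for a bi-invariant Riemannian metric on \<open>G\<close>), and a system of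
  representatives of the unitary dual of \<open>G\<close>.\<close>

record 'a homogeneous_space = "'a lie_group" +
  stab :: "'a set"
  haar :: "'a measure"
  stab_haar :: "'a measure"
  lie_inner :: "'a fun_op \<Rightarrow> 'a fun_op \<Rightarrow> real"
  lie_basis :: "'a fun_op set"
  dual :: "'a matrep set"

definition compact_homogeneous_space :: "'a homogeneous_space \<Rightarrow> bool" where
  "compact_homogeneous_space G \<longleftrightarrow>
     compact_lie_group G \<and>
     subgroup (stab G) G \<and> closedin (lie_top G) (stab G) \<and>
     normalised_haar G (lie_top G) (haar G) \<and>
     normalised_haar (G\<lparr>carrier := stab G\<rparr>) (subtopology (lie_top G) (stab G)) (stab_haar G) \<and>
     invariant_inner G (lie_inner G) \<and> orthonormal_basis G (lie_inner G) (lie_basis G) \<and>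
     unitary_dual G (stab G) (dual G)"

text \<open>The Lie algebra of the closed subgroup \<open>K\<close>: the left-invariant fields that are tangent to \<open>K\<close>
  at the identity.\<close>

definition stab_algebra :: "'a homogeneous_space \<Rightarrow> 'a fun_op set" where
  "stab_algebra G =
     {X \<in> lie_algebra G. \<forall>f\<in>smooth_funs G. (\<forall>k\<in>stab G. f k = 0) \<longrightarrow> X f \<one>\<^bsub>G\<^esub> = 0}"

definition homogeneous_dim :: "'a homogeneous_space \<Rightarrow> nat" where
  "homogeneous_dim G = lie_dim G - vector_space.dim op_scale (stab_algebra G)"

abbreviation cosets :: "'a homogeneous_space \<Rightarrow> 'a set set" where
  "cosets G \<equiv> lcosets\<^bsub>G\<^esub> (stab G)"

abbreviation coset_of :: "'a homogeneous_space \<Rightarrow> 'a \<Rightarrow> 'a set" where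
  "coset_of G g \<equiv> g <#\<^bsub>G\<^esub> stab G"

definition lift :: "'a homogeneous_space \<Rightarrow> ('a set \<Rightarrow> complex) \<Rightarrow> 'a \<Rightarrow> complex" where
  "lift G \<phi> = on_carrier G (\<lambda>g. \<phi> (coset_of G g))"

text \<open>For a right \<open>K\<close>-invariant \<open>h\<close>, the function on \<open>G/K\<close> whose lifting is \<open>h\<close>.\<close>

definition descend :: "'a homogeneous_space \<Rightarrow> ('a \<Rightarrow> complex) \<Rightarrow> 'a set \<Rightarrow> complex" where
  "descend G h C = (if C \<in> cosets G then h (SOME x. x \<in> C) else 0)"

text \<open>The normalised invariant measure on the Borel sets (for the quotient topology) of \<open>G/K\<close>.\<close>

definition coset_borel :: "'a homogeneous_space \<Rightarrow> 'a set measure" where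
  "coset_borel G =
     sigma (cosets G) {S. S \<subseteq> cosets G \<and> openin (lie_top G) {g \<in> carrier G. coset_of G g \<in> S}}"

definition coset_measure :: "'a homogeneous_space \<Rightarrow> 'a set measure" where
  "coset_measure G = distr (haar G) (coset_borel G) (coset_of G)"

definition coset_smooth_funs :: "'a homogeneous_space \<Rightarrow> ('a set \<Rightarrow> complex) set" where
  "coset_smooth_funs G = {\<phi>. lift G \<phi> \<in> smooth_funs G \<and> (\<forall>C. C \<notin> cosets G \<longrightarrow> \<phi> C = 0)}"


subsection \<open>Distributions and Fourier coefficients\<close>

text \<open>Continuity is with respect to the usual Frechet topology, which is generated by the sup-norms
  of all iterated derivatives of the lifting along left-invariant fields.\<close>

definition distributions :: "'a homogeneous_space \<Rightarrow> (('a set \<Rightarrow> complex) \<Rightarrow> complex) set" where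
  "distributions G =
     {u. (\<forall>\<phi>. \<phi> \<notin> coset_smooth_funs G \<longrightarrow> u \<phi> = 0) \<and>
         (\<forall>\<phi>\<in>coset_smooth_funs G. \<forall>\<psi>\<in>coset_smooth_funs G. u (\<phi> + \<psi>) = u \<phi> + u \<psi>) \<and>
         (\<forall>\<phi>\<in>coset_smooth_funs G. \<forall>c. u (\<lambda>C. c * \<phi> C) = c * u \<phi>) \<and>
         (\<exists>M \<F>. finite \<F> \<and> \<F> \<subseteq> lists (lie_algebra G) \<and>
            (\<forall>\<phi>\<in>coset_smooth_funs G.
               cmod (u \<phi>) \<le> M * (\<Sum>Xs\<in>\<F>. SUP x\<in>carrier G. cmod (foldr (\<lambda>X. X) Xs (lift G \<phi>) x))))}"

text \<open>The lifting to \<open>G\<close> of a distribution on \<open>G/K\<close> is the transpose of averaging over \<open>K\<close>; this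
  extends \<^const>\<open>lift\<close> when functions are regarded as distributions via integration.\<close>

definition average :: "'a homogeneous_space \<Rightarrow> ('a \<Rightarrow> complex) \<Rightarrow> 'a set \<Rightarrow> complex" where
  "average G \<psi> = descend G (\<lambda>x. \<integral>k. \<psi> (x \<otimes>\<^bsub>G\<^esub> k) \<partial>stab_haar G)"

definition lift_distribution ::
    "'a homogeneous_space \<Rightarrow> (('a set \<Rightarrow> complex) \<Rightarrow> complex) \<Rightarrow> ('a \<Rightarrow> complex) \<Rightarrow> complex" where
  "lift_distribution G u \<psi> = u (average G \<psi>)"

definition fourier_coeff ::
    "'a homogeneous_space \<Rightarrow> (('a set \<Rightarrow> complex) \<Rightarrow> complex) \<Rightarrow> 'a matrep \<Rightarrow> complex mat" where
  "fourier_coeff G u \<xi> =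
     mat (rep_dim G \<xi>) (rep_dim G \<xi>)
       (\<lambda>(i, j). lift_distribution G u (on_carrier G (\<lambda>x. mat_adjoint (\<xi> x) $$ (i, j))))"

definition class_I :: "'a homogeneous_space \<Rightarrow> 'a matrep set" where
  "class_I G = {\<xi> \<in> dual G. \<exists>v\<in>invariant_vecs G (stab G) \<xi>. v \<noteq> 0\<^sub>v (rep_dim G \<xi>)}"

definition laplace_G :: "'a homogeneous_space \<Rightarrow> ('a \<Rightarrow> complex) \<Rightarrow> 'a \<Rightarrow> complex" where
  "laplace_G G f = (\<Sum>X\<in>lie_basis G. X (X f))"

definition laplace :: "'a homogeneous_space \<Rightarrow> ('a set \<Rightarrow> complex) \<Rightarrow> 'a set \<Rightarrow> complex" where
  "laplace G \<phi> = descend G (laplace_G G (lift G \<phi>))"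

text \<open>\<open>c \<ge> 1\<close> is the eigenvalue of the positive square root of \<open>1 - laplace\<close> on the matrix entries
  in the first \<^const>\<open>inv_dim\<close> columns of \<open>\<xi>\<close>, regarded as functions on \<open>G/K\<close>.\<close>

definition weight :: "'a homogeneous_space \<Rightarrow> 'a matrep \<Rightarrow> real" where
  "weight G \<xi> = (THE c. c \<ge> 1 \<and>
     (\<forall>i<rep_dim G \<xi>. \<forall>j<inv_dim G (stab G) \<xi>.
        let \<phi> = descend G (\<lambda>x. \<xi> x $$ (i, j)) in \<phi> - laplace G \<phi> = (\<lambda>C. of_real (c\<^sup>2) * \<phi> C)))"

text \<open>The convention that the columns of \<open>\<xi> x\<close> from index \<^const>\<open>inv_dim\<close> on are replaced by \<open>0\<close>.\<close>

definition truncated :: "'a homogeneous_space \<Rightarrow> 'a matrep \<Rightarrow> 'a \<Rightarrow> complex mat" where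
  "truncated G \<xi> x = mat (rep_dim G \<xi>) (rep_dim G \<xi>)
     (\<lambda>(i, j). if j < inv_dim G (stab G) \<xi> then \<xi> x $$ (i, j) else 0)"

definition mat_trace :: "complex mat \<Rightarrow> complex" where
  "mat_trace A = (\<Sum>i<dim_row A. A $$ (i, i))"

text \<open>The index set of the following sum is finite, since the Laplacian on a compact manifold has
  finitely many eigenvalues, with multiplicity, in any bounded set.\<close>

definition dyadic_block ::
    "'a homogeneous_space \<Rightarrow> (('a set \<Rightarrow> complex) \<Rightarrow> complex) \<Rightarrow> nat \<Rightarrow> 'a set \<Rightarrow> complex" where
  "dyadic_block G f s = descend G (\<lambda>x.
     \<Sum>\<xi> | \<xi> \<in> class_I G \<and> 2 ^ s \<le> weight G \<xi> \<and> weight G \<xi> < 2 ^ (s + 1).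
       of_nat (rep_dim G \<xi>) * mat_trace (fourier_coeff G f \<xi> * truncated G \<xi> x))"


section \<open>Besov and Triebel--Lizorkin spaces\<close>

text \<open>Powers with positive exponent.\<close>

definition epow :: "ennreal \<Rightarrow> real \<Rightarrow> ennreal" where
  "epow x a = (if x = \<infinity> then \<infinity> else ennreal (enn2real x powr a))"

definition Lp_norm :: "ennreal \<Rightarrow> 'b measure \<Rightarrow> ('b \<Rightarrow> ennreal) \<Rightarrow> ennreal" where
  "Lp_norm p M h =
     (if p = \<infinity> then esssup M h
      else epow (\<integral>\<^sup>+x. epow (h x) (enn2real p) \<partial>M) (1 / enn2real p))"

definition weighted_lq_norm :: "real \<Rightarrow> ennreal \<Rightarrow> (nat \<Rightarrow> ennreal) \<Rightarrow> ennreal" where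
  "weighted_lq_norm r q a =
     (if q = \<infinity> then (SUP s. ennreal (2 powr (real s * r)) * a s)
      else epow (\<Sum>s. ennreal (2 powr (real s * r * enn2real q)) * epow (a s) (enn2real q))
             (1 / enn2real q))"

definition besov_norm ::
    "'a homogeneous_space \<Rightarrow> real \<Rightarrow> ennreal \<Rightarrow> ennreal \<Rightarrow> (('a set \<Rightarrow> complex) \<Rightarrow> complex) \<Rightarrow> ennreal" where
  "besov_norm G r p q f =
     weighted_lq_norm r q (\<lambda>s. Lp_norm p (coset_measure G) (\<lambda>x. ennreal (cmod (dyadic_block G f s x))))"

definition triebel_lizorkin_norm ::
    "'a homogeneous_space \<Rightarrow> real \<Rightarrow> ennreal \<Rightarrow> ennreal \<Rightarrow> (('a set \<Rightarrow> complex) \<Rightarrow> complex) \<Rightarrow> ennreal" where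
  "triebel_lizorkin_norm G r p q f =
     Lp_norm p (coset_measure G)
       (\<lambda>x. weighted_lq_norm r q (\<lambda>s. ennreal (cmod (dyadic_block G f s x))))"

type_synonym 'x quasi_normed = "'x set \<times> ('x \<Rightarrow> ennreal)"

definition besov ::
    "'a homogeneous_space \<Rightarrow> real \<Rightarrow> ennreal \<Rightarrow> ennreal \<Rightarrow> (('a set \<Rightarrow> complex) \<Rightarrow> complex) quasi_normed" where
  "besov G r p q = ({f \<in> distributions G. besov_norm G r p q f < \<infinity>}, besov_norm G r p q)"

definition triebel_lizorkin ::
    "'a homogeneous_space \<Rightarrow> real \<Rightarrow> ennreal \<Rightarrow> ennreal \<Rightarrow> (('a set \<Rightarrow> complex) \<Rightarrow> complex) quasi_normed" where
  "triebel_lizorkin G r p q =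
     ({f \<in> distributions G. triebel_lizorkin_norm G r p q f < \<infinity>}, triebel_lizorkin_norm G r p q)"

text \<open>Continuous embedding; for a linear map of quasi-normed spaces continuity is boundedness.\<close>

definition embeds :: "'x quasi_normed \<Rightarrow> 'x quasi_normed \<Rightarrow> bool" (infix "\<hookrightarrow>" 50) where
  "V \<hookrightarrow> W \<longleftrightarrow> fst V \<subseteq> fst W \<and> (\<exists>c::real. \<forall>f\<in>fst V. snd W f \<le> ennreal c * snd V f)"

definition same_space :: "'x quasi_normed \<Rightarrow> 'x quasi_normed \<Rightarrow> bool" (infix "\<cong>\<^sub>s" 50) where
  "V \<cong>\<^sub>s W \<longleftrightarrow> fst V = fst W \<and> V \<hookrightarrow> W \<and> W \<hookrightarrow> V"

end

theory Submission
  imports Defs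
begin

text \<open>Triebel--Lizorkin norms are \<open>L\<^sup>p(\<ell>\<^sup>q)\<close> norms and Besov norms are \<open>\<ell>\<^sup>q(L\<^sup>p)\<close> norms of the sequence
  \<open>2\<^sup>s\<^sup>r \<bar>f\<^sub>s\<bar>\<close>. Parts (1) and (2) hold pointwise on \<open>G/K\<close>, since \<open>\<ell>\<^sup>q\<close> increases with \<open>q\<close> and a weight
  \<open>2\<^sup>s\<^sup>\<epsilon>\<close> embeds \<open>\<ell>\<^sup>\<infinity>\<close> in every \<open>\<ell>\<^sup>q\<close>. For (4), Minkowski's inequality in \<open>L\<^sup>p\<^sup>/\<^sup>q\<close> gives \<open>B \<hookrightarrow> F\<close> if
  \<open>q \<le> p\<close>, and in \<open>\<ell>\<^sup>q\<^sup>/\<^sup>p\<close> it gives \<open>F \<hookrightarrow> B\<close> if \<open>p \<le> q\<close>; (3) is the case \<open>p = q\<close>, and the remaining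
  halves of (4) follow by monotonicity in \<open>q\<close>. The only input from the geometry is that the blocks
  \<open>f\<^sub>s\<close> are Borel functions on \<open>G/K\<close>: they lift to continuous functions because the first \<open>k\<^sub>\<xi>\<close> columns
  of \<open>\<xi>\<close> are right \<open>K\<close>-invariant.\<close>

hide_const (open) Order.top

section \<open>Powers of extended nonnegative reals and Minkowski inequalities\<close>

lemma epow_ennreal: "0 \<le> x \<Longrightarrow> epow (ennreal x) a = ennreal (x powr a)"
  by (simp add: epow_def)

lemma epow_top [simp]: "epow top a = top"
  by (simp add: epow_def)

text \<open>As \<open>0 powr a = 0\<close> for every \<open>a\<close>, all exponents fix both 0 and
  \<open>top\<close>, even 0 and negative ones; the laws for products and sums of exponents then
  hold without sign conditions.\<close>

lemma epow_0 [simp]: "epow 0 a = 0"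
  by (simp add: epow_def)

lemma epow_1 [simp]: "epow x 1 = x"
  by (cases x) (auto simp: epow_ennreal)

lemma epow_eq_0_iff [simp]: "epow x a = 0 \<longleftrightarrow> x = 0"
  by (cases x) (auto simp: epow_ennreal)

lemma epow_eq_top_iff [simp]: "epow x a = top \<longleftrightarrow> x = top"
  by (cases x) (auto simp: epow_ennreal)

lemma epow_less_top_iff [simp]: "epow x a < top \<longleftrightarrow> x < top"
  by (simp add: less_top[symmetric])

lemma epow_mono: "0 \<le> a \<Longrightarrow> x \<le> y \<Longrightarrow> epow x a \<le> epow y a"
  by (cases x; cases y) (auto simp: epow_ennreal powr_mono2 top_unique)

lemma epow_mult: "epow (x * y) a = epow x a * epow y a"
proof (cases "x = 0 \<or> y = 0 \<or> x = top \<or> y = top")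
  case True
  then show ?thesis
    by (auto simp: ennreal_mult_eq_top_iff ennreal_top_mult ennreal_mult_top)
next
  case False
  then show ?thesis
    by (cases x; cases y) (auto simp: epow_ennreal powr_mult simp flip: ennreal_mult)
qed

lemma epow_epow: "epow (epow x a) b = epow x (a * b)"
  by (cases x) (auto simp: epow_ennreal powr_powr)

lemma epow_add: "epow x (a + b) = epow x a * epow x b"
  by (cases x) (auto simp: epow_ennreal powr_add ennreal_mult ennreal_top_mult)

lemma epow_inverse [simp]: "a \<noteq> 0 \<Longrightarrow> epow (epow x a) (1 / a) = x"
  "a \<noteq> 0 \<Longrightarrow> epow (epow x (1 / a)) a = x"
  by (simp_all add: epow_epow)

lemma epow_le_iff: "0 < a \<Longrightarrow> epow x a \<le> y \<longleftrightarrow> x \<le> epow y (1 / a)"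
  using epow_mono[of "1 / a" "epow x a" y] epow_mono[of a x "epow y (1 / a)"] by auto

text \<open>A positive power is an order isomorphism with inverse exponent \<open>1 / a\<close>,
  hence commutes with suprema.\<close>

lemma epow_SUP: "0 < a \<Longrightarrow> epow (SUP i\<in>I. f i) a = (SUP i\<in>I. epow (f i) a)"
proof (rule antisym)
  assume a: "0 < a"
  have "f i \<le> epow (SUP i\<in>I. epow (f i) a) (1 / a)" if "i \<in> I" for i
    using a that by (auto intro: SUP_upper simp flip: epow_le_iff)
  with a show "epow (SUP i\<in>I. f i) a \<le> (SUP i\<in>I. epow (f i) a)"
    by (auto simp: epow_le_iff intro: SUP_least)
qed (auto intro!: SUP_least epow_mono intro: SUP_upper)

lemma measurable_epow [measurable]:
  assumes [measurable]: "f \<in> borel_measurable M"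
  shows "(\<lambda>x. epow (f x) a) \<in> borel_measurable M"
  unfolding epow_def by measurable

section \<open>Young and Holder inequalities\<close>

text \<open>Weighted AM-GM with weights 1/t and 1 - 1/t for x^t and y^t. Writing the second factor
  as y^(t-1) keeps the conjugate exponent out of the Holder inequality.\<close>

lemma ennreal_Young:
  fixes x y :: ennreal
  assumes t: "1 < t"
  shows "x * epow y (t - 1) \<le> ennreal (1 / t) * epow x t + ennreal (1 - 1 / t) * epow y t"
proof (cases "x = 0 \<or> y = 0 \<or> x = top \<or> y = top")
  case True
  then show ?thesis
    using t by (auto simp: ennreal_mult_top)
next
  case False
  then obtain a b where ab: "x = ennreal a" "y = ennreal b" "0 < a" "0 < b"
    by (cases x; cases y) (auto simp: less_le)
  have "a * b powr (t - 1) = (a powr t) powr (1 / t) * (b powr t) powr (1 - 1 / t)"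
    using t ab by (simp add: powr_powr algebra_simps)
  also have "\<dots> \<le> (1 / t) * a powr t + (1 - 1 / t) * b powr t"
    using t ab by (intro Youngs_inequality_0) auto
  finally have "a * b powr (t - 1) \<le> (1 / t) * a powr t + (1 - 1 / t) * b powr t" .
  then show ?thesis
    using ab t by (simp add: epow_ennreal flip: ennreal_mult ennreal_plus)
qed

text \<open>Normalise both functions to norm one and integrate Young's inequality. The last factor
  is the norm of g^(t-1) in the conjugate space.\<close>

lemma nn_integral_Holder:
  assumes [measurable]: "f \<in> borel_measurable M" "g \<in> borel_measurable M" and t: "1 < t"
  shows "(\<integral>\<^sup>+x. f x * epow (g x) (t - 1) \<partial>M) \<le>
    epow (\<integral>\<^sup>+x. epow (f x) t \<partial>M) (1 / t) * epow (epow (\<integral>\<^sup>+x. epow (g x) t \<partial>M) (1 / t)) (t - 1)"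
    (is "?I \<le> epow ?F _ * epow (epow ?G _) _")
proof (cases "?F = 0 \<or> ?G = 0 \<or> ?F = top \<or> ?G = top")
  case True
  \<comment> \<open>A vanishing norm kills the integrand almost everywhere; otherwise an infinite
    norm meets a nonzero factor and the right side is \<open>top\<close>.\<close>
  have "?I = 0" if "?F = 0 \<or> ?G = 0"
    using that by (auto simp: nn_integral_0_iff_AE)
  with True show ?thesis
    by (cases "?F = 0 \<or> ?G = 0") (auto simp: ennreal_mult_top ennreal_top_mult)
next
  case False
  define A where "A = enn2real (epow ?F (1 / t))"
  define B where "B = enn2real (epow ?G (1 / t))"
  have AB: "epow ?F (1 / t) = ennreal A" "epow ?G (1 / t) = ennreal B"
    using False unfolding A_def B_def by (auto simp: less_top)
  then have pos: "0 < A" "0 < B"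
    using False by (metis epow_eq_0_iff ennreal_eq_zero_iff linorder_not_le ennreal_neg)+
  have F: "?F = ennreal (A powr t)" and G: "?G = ennreal (B powr t)"
    using arg_cong[OF AB(1), of "\<lambda>x. epow x t"] arg_cong[OF AB(2), of "\<lambda>x. epow x t"] t pos
    by (simp_all add: epow_ennreal)
  \<comment> \<open>Young's inequality for f/A and g/B, rescaled by A B^(t-1).\<close>
  have pw: "f x * epow (g x) (t - 1) \<le> ennreal (A * B powr (t - 1)) *
      (ennreal (1 / t / A powr t) * epow (f x) t + ennreal ((1 - 1 / t) / B powr t) * epow (g x) t)"
    for x
  proof -
    have "f x * epow (g x) (t - 1) = ennreal (A * B powr (t - 1)) *
       ((ennreal (1 / A) * f x) * epow (ennreal (1 / B) * g x) (t - 1))"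
    proof -
      have "ennreal (A * B powr (t - 1)) * ((ennreal (1 / A) * f x) * epow (ennreal (1 / B) * g x) (t - 1))
        = (ennreal (A * B powr (t - 1)) * ennreal (1 / A) * ennreal ((1 / B) powr (t - 1)))
          * (f x * epow (g x) (t - 1))"
        using pos by (simp add: epow_mult epow_ennreal ac_simps)
      also have "ennreal (A * B powr (t - 1)) * ennreal (1 / A) * ennreal ((1 / B) powr (t - 1)) = 1"
        using pos by (simp add: powr_divide flip: ennreal_mult)
      finally show ?thesis by simp
    qed
    also have "(ennreal (1 / A) * f x) * epow (ennreal (1 / B) * g x) (t - 1) \<le>
        ennreal (1 / t) * epow (ennreal (1 / A) * f x) t
        + ennreal (1 - 1 / t) * epow (ennreal (1 / B) * g x) t"
      by (rule ennreal_Young[OF t])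
    also have "\<dots> = ennreal (1 / t / A powr t) * epow (f x) t + ennreal ((1 - 1 / t) / B powr t) * epow (g x) t"
      using pos t by (simp add: epow_mult epow_ennreal powr_divide ennreal_mult[symmetric] flip: mult.assoc)
    finally show ?thesis by (simp add: mult_left_mono)
  qed
  have "?I \<le> (\<integral>\<^sup>+x. ennreal (A * B powr (t - 1)) *
      (ennreal (1 / t / A powr t) * epow (f x) t + ennreal ((1 - 1 / t) / B powr t) * epow (g x) t) \<partial>M)"
    by (intro nn_integral_mono pw)
  also have "\<dots> = ennreal (A * B powr (t - 1)) *
      (ennreal (1 / t / A powr t) * ?F + ennreal ((1 - 1 / t) / B powr t) * ?G)"
    by (simp add: nn_integral_cmult nn_integral_add)
  \<comment> \<open>The powers of A and B cancel, and the weights 1/t and 1 - 1/t add up to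
    1.\<close>
  also have "\<dots> = ennreal (A * B powr (t - 1))"
    using pos t by (simp add: F G flip: ennreal_mult ennreal_plus)
  also have "\<dots> = epow ?F (1 / t) * epow (epow ?G (1 / t)) (t - 1)"
    using pos by (simp add: AB epow_ennreal ennreal_mult)
  finally show ?thesis .
qed

section \<open>Minkowski inequalities for sums and integrals\<close>

text \<open>Both Minkowski proofs for finite sums end by cancelling a (t-1)-st power of the left
  side, which is why its finiteness is proved first.\<close>

lemma le_if_epow_le_mult_epow:
  assumes "x < top" "epow x t \<le> y * epow x (t - 1)"
  shows "x \<le> y"
proof (cases "x = 0")
  case False
  have "x * epow x (t - 1) \<le> y * epow x (t - 1)"
    using assms(2) epow_add[of x 1 "t - 1"] by simp
  with False assms(1) show ?thesis
    by (simp add: ennreal_mult_le_mult_iff mult.commute[of _ "epow x (t - 1)"])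
qed simp

text \<open>A crude bound that serves to show finiteness: each summand is at most the
  \<open>t\<close>-th root of the sum of \<open>t\<close>-th powers.\<close>

lemma epow_sum_le:
  assumes "finite F" "0 < t"
  shows "epow (\<Sum>s\<in>F. a s) t \<le> epow (of_nat (card F)) t * (\<Sum>s\<in>F. epow (a s) t)"
proof -
  let ?m = "epow (\<Sum>s\<in>F. epow (a s) t) (1 / t)"
  have "a s \<le> ?m" if "s \<in> F" for s
    using assms that by (auto simp flip: epow_le_iff intro: member_le_sum)
  then have "(\<Sum>s\<in>F. a s) \<le> of_nat (card F) * ?m"
    by (intro sum_bounded_above) auto
  then have "epow (\<Sum>s\<in>F. a s) t \<le> epow (of_nat (card F) * ?m) t"
    using assms by (intro epow_mono) auto
  then show ?thesis
    using assms by (simp add: epow_mult)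
qed

text \<open>Expand one factor of g^t = g g^(t-1), where g is the sum, apply Holder to each term and
  cancel the power t-1 of the norm of g.\<close>

lemma nn_integral_Minkowski_sum:
  assumes F: "finite F" and [measurable]: "\<And>s. s \<in> F \<Longrightarrow> h s \<in> borel_measurable M" and t: "1 \<le> t"
  shows "epow (\<integral>\<^sup>+x. epow (\<Sum>s\<in>F. h s x) t \<partial>M) (1 / t) \<le>
    (\<Sum>s\<in>F. epow (\<integral>\<^sup>+x. epow (h s x) t \<partial>M) (1 / t))" (is "?X \<le> ?Y")
proof (cases "t = 1 \<or> ?Y = top")
  case True
  then show ?thesis by (auto simp: nn_integral_sum)
next
  case False
  with t have t: "1 < t" and "?Y < top" by (auto simp: less_top)
  then have fin: "(\<integral>\<^sup>+x. epow (h s x) t \<partial>M) < top" if "s \<in> F" for s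
    using F that by simp
  define g where "g x = (\<Sum>s\<in>F. h s x)" for x
  have [measurable]: "g \<in> borel_measurable M"
    unfolding g_def by measurable
  have "(\<integral>\<^sup>+x. epow (g x) t \<partial>M) \<le>
      (\<integral>\<^sup>+x. epow (of_nat (card F)) t * (\<Sum>s\<in>F. epow (h s x) t) \<partial>M)"
    unfolding g_def using t F by (intro nn_integral_mono epow_sum_le) auto
  also have "\<dots> = epow (of_nat (card F)) t * (\<Sum>s\<in>F. \<integral>\<^sup>+x. epow (h s x) t \<partial>M)"
    by (simp add: nn_integral_cmult nn_integral_sum)
  also have "\<dots> < top"
    using fin F by (simp add: less_top[symmetric] ennreal_mult_eq_top_iff)
  finally have "?X < top"
    by (auto simp: g_def less_top)
  moreover have "epow ?X t \<le> ?Y * epow ?X (t - 1)"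
  proof -
    have "epow ?X t = (\<integral>\<^sup>+x. epow (g x) (1 + (t - 1)) \<partial>M)"
      using t by (simp add: g_def)
    also have "\<dots> = (\<integral>\<^sup>+x. (\<Sum>s\<in>F. h s x * epow (g x) (t - 1)) \<partial>M)"
      unfolding epow_add by (simp add: sum_distrib_right g_def)
    also have "\<dots> = (\<Sum>s\<in>F. \<integral>\<^sup>+x. h s x * epow (g x) (t - 1) \<partial>M)"
      by (intro nn_integral_sum) auto
    also have "\<dots> \<le> (\<Sum>s\<in>F. epow (\<integral>\<^sup>+x. epow (h s x) t \<partial>M) (1 / t) * epow ?X (t - 1))"
      unfolding g_def[symmetric] using t by (intro sum_mono nn_integral_Holder) auto
    finally show ?thesis by (simp add: sum_distrib_right)
  qed
  ultimately show ?thesis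
    by (rule le_if_epow_le_mult_epow)
qed

text \<open>Partial sums increase, so monotone convergence and \<open>epow_SUP\<close> reduce this
  to finite sums.\<close>

lemma nn_integral_Minkowski_suminf:
  assumes [measurable]: "\<And>s. h s \<in> borel_measurable M" and t: "1 \<le> t"
  shows "epow (\<integral>\<^sup>+x. epow (\<Sum>s. h s x) t \<partial>M) (1 / t) \<le>
    (\<Sum>s. epow (\<integral>\<^sup>+x. epow (h s x) t \<partial>M) (1 / t))"
proof -
  have "(\<integral>\<^sup>+x. epow (\<Sum>s. h s x) t \<partial>M) = (\<integral>\<^sup>+x. (SUP n. epow (\<Sum>s<n. h s x) t) \<partial>M)"
    using t by (simp add: suminf_eq_SUP epow_SUP)
  also have "\<dots> = (SUP n. \<integral>\<^sup>+x. epow (\<Sum>s<n. h s x) t \<partial>M)"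
    using t by (intro nn_integral_monotone_convergence_SUP)
      (auto simp: incseq_def le_fun_def intro!: epow_mono sum_mono2)
  finally have "epow (\<integral>\<^sup>+x. epow (\<Sum>s. h s x) t \<partial>M) (1 / t) =
      (SUP n. epow (\<integral>\<^sup>+x. epow (\<Sum>s<n. h s x) t \<partial>M) (1 / t))"
    using t by (simp add: epow_SUP)
  also have "\<dots> \<le> (SUP n. \<Sum>s<n. epow (\<integral>\<^sup>+x. epow (h s x) t \<partial>M) (1 / t))"
    using t by (intro SUP_mono') (auto intro: nn_integral_Minkowski_sum)
  finally show ?thesis by (simp add: suminf_eq_SUP)
qed

lemma sum_Holder:
  fixes a b :: "'b \<Rightarrow> ennreal"
  assumes "finite F" "1 < t"
  shows "(\<Sum>s\<in>F. a s * epow (b s) (t - 1)) \<le>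
    epow (\<Sum>s\<in>F. epow (a s) t) (1 / t) * epow (epow (\<Sum>s\<in>F. epow (b s) t) (1 / t)) (t - 1)"
  using nn_integral_Holder[of a "count_space F" b t] assms
  by (simp add: nn_integral_count_space_finite)

text \<open>The roles of sum and integral are exchanged: Holder is applied in \<open>s\<close> for
  each fixed \<open>x\<close>, with the integrals of the \<open>a s\<close> as second
  sequence.\<close>

lemma Minkowski_sum_nn_integral:
  assumes F: "finite F" and [measurable]: "\<And>s. s \<in> F \<Longrightarrow> a s \<in> borel_measurable M" and t: "1 \<le> t"
  shows "epow (\<Sum>s\<in>F. epow (\<integral>\<^sup>+x. a s x \<partial>M) t) (1 / t) \<le>
    (\<integral>\<^sup>+x. epow (\<Sum>s\<in>F. epow (a s x) t) (1 / t) \<partial>M)" (is "?X \<le> ?Y")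
proof (cases "t = 1 \<or> ?Y = top")
  case True
  then show ?thesis by (auto simp: nn_integral_sum)
next
  case False
  with t have t: "1 < t" and Y: "?Y < top" by (auto simp: less_top)
  \<comment> \<open>A coordinate is at most the l^t norm; as \<open>F\<close> is finite, this makes
    \<open>?X\<close> finite.\<close>
  have "(\<integral>\<^sup>+x. a s x \<partial>M) \<le> ?Y" if "s \<in> F" for s
    using t F that by (auto intro!: nn_integral_mono member_le_sum simp flip: epow_le_iff)
  then have "?X < top"
    using F Y by (auto intro: le_less_trans)
  moreover have "epow ?X t \<le> ?Y * epow ?X (t - 1)"
  proof -
    let ?N = "\<lambda>s. \<integral>\<^sup>+x. a s x \<partial>M"
    have "epow ?X t = (\<Sum>s\<in>F. epow (?N s) (1 + (t - 1)))"
      using t by simp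
    also have "\<dots> = (\<Sum>s\<in>F. \<integral>\<^sup>+x. a s x * epow (?N s) (t - 1) \<partial>M)"
      unfolding epow_add by (simp add: nn_integral_multc)
    also have "\<dots> = (\<integral>\<^sup>+x. (\<Sum>s\<in>F. a s x * epow (?N s) (t - 1)) \<partial>M)"
      by (intro nn_integral_sum[symmetric]) auto
    also have "\<dots> \<le> (\<integral>\<^sup>+x. epow (\<Sum>s\<in>F. epow (a s x) t) (1 / t) * epow ?X (t - 1) \<partial>M)"
      using t F by (intro nn_integral_mono sum_Holder) auto
    also have "\<dots> = ?Y * epow ?X (t - 1)"
      by (intro nn_integral_multc) auto
    finally show ?thesis .
  qed
  ultimately show ?thesis
    by (rule le_if_epow_le_mult_epow)
qed

lemma Minkowski_suminf_nn_integral: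
  assumes [measurable]: "\<And>s. a s \<in> borel_measurable M" and t: "1 \<le> t"
  shows "epow (\<Sum>s. epow (\<integral>\<^sup>+x. a s x \<partial>M) t) (1 / t) \<le>
    (\<integral>\<^sup>+x. epow (\<Sum>s. epow (a s x) t) (1 / t) \<partial>M)"
proof -
  have "epow (\<Sum>s. epow (\<integral>\<^sup>+x. a s x \<partial>M) t) (1 / t)
      = (SUP n. epow (\<Sum>s<n. epow (\<integral>\<^sup>+x. a s x \<partial>M) t) (1 / t))"
    using t by (simp add: suminf_eq_SUP epow_SUP)
  also have "\<dots> \<le> (\<integral>\<^sup>+x. epow (\<Sum>s. epow (a s x) t) (1 / t) \<partial>M)"
  proof (rule SUP_least)
    fix n
    have "epow (\<Sum>s<n. epow (\<integral>\<^sup>+x. a s x \<partial>M) t) (1 / t) \<le>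
        (\<integral>\<^sup>+x. epow (\<Sum>s<n. epow (a s x) t) (1 / t) \<partial>M)"
      using t by (intro Minkowski_sum_nn_integral) auto
    also have "\<dots> \<le> (\<integral>\<^sup>+x. epow (\<Sum>s. epow (a s x) t) (1 / t) \<partial>M)"
      using t by (intro nn_integral_mono epow_mono sum_le_suminf) auto
    finally show "epow (\<Sum>s<n. epow (\<integral>\<^sup>+x. a s x \<partial>M) t) (1 / t) \<le>
      (\<integral>\<^sup>+x. epow (\<Sum>s. epow (a s x) t) (1 / t) \<partial>M)" .
  qed
  finally show ?thesis .
qed

section \<open>Mixed norms\<close>

text \<open>Carries no weight: the factor 2^(sr) is absorbed into the sequence, so that different
  \<open>r\<close> are compared within one norm.\<close>

definition lq_norm :: "ennreal \<Rightarrow> (nat \<Rightarrow> ennreal) \<Rightarrow> ennreal" where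
  "lq_norm q b = (if q = top then (SUP s. b s)
     else epow (\<Sum>s. epow (b s) (enn2real q)) (1 / enn2real q))"

lemma weighted_lq_norm_eq_lq_norm:
  "weighted_lq_norm r q a = lq_norm q (\<lambda>s. ennreal (2 powr (real s * r)) * a s)"
  by (simp add: weighted_lq_norm_def lq_norm_def epow_mult epow_ennreal powr_powr)

lemma Lp_norm_top [simp]: "Lp_norm top M h = esssup M h"
  by (simp add: Lp_norm_def)

lemma lq_norm_top [simp]: "lq_norm top b = (SUP s. b s)"
  by (simp add: lq_norm_def)

lemma Lp_norm_ennreal:
  "0 \<le> p \<Longrightarrow> Lp_norm (ennreal p) M h = epow (\<integral>\<^sup>+x. epow (h x) p \<partial>M) (1 / p)"
  by (simp add: Lp_norm_def)

lemma lq_norm_ennreal: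
  "0 \<le> q \<Longrightarrow> lq_norm (ennreal q) b = epow (\<Sum>s. epow (b s) q) (1 / q)"
  by (simp add: lq_norm_def)

lemma le_lq_norm:
  assumes "0 < q"
  shows "b s \<le> lq_norm q b"
proof (cases q)
  case (real t)
  have "epow (b s) t \<le> (\<Sum>s. epow (b s) t)"
    using sum_le_suminf[of "\<lambda>s. epow (b s) t" "{s}"] by auto
  then show ?thesis
    using assms real by (simp add: lq_norm_ennreal flip: epow_le_iff)
qed (auto intro: SUP_upper)

text \<open>Every term is at most N, the norm with the smaller exponent t, so b^u <= b^t N^(u-t);
  summation gives N^u.\<close>

lemma lq_norm_antimono:
  assumes "0 < q1" "q1 \<le> q2"
  shows "lq_norm q2 b \<le> lq_norm q1 b"
proof (cases q2)
  case top
  then show ?thesis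
    using assms by (auto intro: SUP_least le_lq_norm)
next
  case (real u)
  with assms obtain t where t: "q1 = ennreal t" "0 < t" "t \<le> u"
    by (cases q1) (auto simp: top_unique)
  let ?N = "lq_norm q1 b"
  show ?thesis
  proof (cases "t = u")
    case False
    have "(\<Sum>s. epow (b s) u) = (\<Sum>s. epow (b s) t * epow (b s) (u - t))"
      by (simp flip: epow_add)
    also have "\<dots> \<le> (\<Sum>s. epow (b s) t * epow ?N (u - t))"
      using assms t by (intro suminf_le mult_left_mono epow_mono le_lq_norm) auto
    also have "\<dots> = epow ?N t * epow ?N (u - t)"
      using t by (simp add: lq_norm_ennreal)
    also have "\<dots> = epow ?N u"
      by (simp flip: epow_add)
    finally show ?thesis
      using t real by (simp add: lq_norm_ennreal[of u] epow_le_iff[symmetric] epow_epow epow_le_iff)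
  qed (use t real in simp)
qed

text \<open>If S is the weighted supremum, then b_s <= 2^(-s \<epsilon>) S, and a geometric series
  of ratio \<open>\<rho>\<close> dominates the sum. The constant is independent of \<open>b\<close>,
  so it serves all points of G/K at once.\<close>

lemma lq_norm_le_SUP_weighted:
  assumes "0 < q" "q < top" "0 < \<epsilon>"
  obtains c :: real where "\<And>b. lq_norm q b \<le> ennreal c * (SUP s. ennreal (2 powr (real s * \<epsilon>)) * b s)"
proof -
  obtain t where t: "q = ennreal t" "0 < t"
    using assms by (cases q) auto
  define \<rho> where "\<rho> = 2 powr (- \<epsilon> * t)"
  have "- \<epsilon> * t < 0"
    using assms t by simp
  then have \<rho>: "0 < \<rho>" "\<rho> < 1"
    unfolding \<rho>_def by (auto simp: powr_less_one)
  have "lq_norm q b \<le> ennreal ((1 / (1 - \<rho>)) powr (1 / t)) * (SUP s. ennreal (2 powr (real s * \<epsilon>)) * b s)"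
    (is "_ \<le> _ * ?S") for b
  proof -
    have "epow (b s) t \<le> ennreal (\<rho> ^ s) * epow ?S t" for s
    proof -
      have "b s = ennreal (2 powr (- real s * \<epsilon>)) * (ennreal (2 powr (real s * \<epsilon>)) * b s)"
        by (simp add: powr_minus flip: mult.assoc ennreal_mult)
      also have "\<dots> \<le> ennreal (2 powr (- real s * \<epsilon>)) * ?S"
        by (intro mult_left_mono SUP_upper) auto
      finally have "epow (b s) t \<le> epow (ennreal (2 powr (- real s * \<epsilon>)) * ?S) t"
        using t by (intro epow_mono) auto
      also have "\<dots> = ennreal (\<rho> ^ s) * epow ?S t"
        by (simp add: epow_mult epow_ennreal \<rho>_def powr_powr ac_simps flip: powr_realpow)
      finally show ?thesis .
    qed
    then have "(\<Sum>s. epow (b s) t) \<le> (\<Sum>s. ennreal (\<rho> ^ s) * epow ?S t)"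
      by (intro suminf_le) auto
    also have "\<dots> = (\<Sum>s. ennreal (\<rho> ^ s)) * epow ?S t"
      by simp
    also have "(\<Sum>s. ennreal (\<rho> ^ s)) = ennreal (1 / (1 - \<rho>))"
      using \<rho> geometric_sums[of \<rho>] by (intro suminf_ennreal_eq) auto
    finally have "epow (\<Sum>s. epow (b s) t) (1 / t) \<le> epow (ennreal (1 / (1 - \<rho>)) * epow ?S t) (1 / t)"
      using t by (intro epow_mono) auto
    then show ?thesis
      using t \<rho> by (simp add: lq_norm_ennreal epow_mult epow_ennreal)
  qed
  then show thesis by (rule that)
qed

lemma lq_norm_mono: "0 < q \<Longrightarrow> (\<And>s. a s \<le> b s) \<Longrightarrow> lq_norm q a \<le> lq_norm q b"
  by (cases q) (auto simp: lq_norm_ennreal intro!: epow_mono suminf_le SUP_mono')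

lemma measurable_lq_norm [measurable]:
  assumes [measurable]: "\<And>s. h s \<in> borel_measurable M"
  shows "(\<lambda>x. lq_norm q (\<lambda>s. h s x)) \<in> borel_measurable M"
  unfolding lq_norm_def by measurable

section \<open>L^p norms and the order of mixed norms\<close>

text \<open>Carries pointwise estimates over to L^p, including p = infinity, where \<open>g\<close>
  is below its essential supremum only almost everywhere.\<close>

lemma Lp_norm_le_mult:
  assumes p: "0 < p" and [measurable]: "f \<in> borel_measurable M" "g \<in> borel_measurable M"
    and le: "\<And>x. f x \<le> c * g x"
  shows "Lp_norm p M f \<le> c * Lp_norm p M g"
proof (cases p)
  case (real t)
  have "(\<integral>\<^sup>+x. epow (f x) t \<partial>M) \<le> (\<integral>\<^sup>+x. epow c t * epow (g x) t \<partial>M)"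
    using le p real by (intro nn_integral_mono) (auto intro!: epow_mono simp flip: epow_mult)
  also have "\<dots> = epow c t * (\<integral>\<^sup>+x. epow (g x) t \<partial>M)"
    by (simp add: nn_integral_cmult)
  finally have "epow (\<integral>\<^sup>+x. epow (f x) t \<partial>M) (1 / t) \<le> epow (epow c t * (\<integral>\<^sup>+x. epow (g x) t \<partial>M)) (1 / t)"
    using p real by (intro epow_mono) auto
  then show ?thesis
    using p real by (simp add: Lp_norm_ennreal epow_mult)
next
  case top
  have "AE x in M. f x \<le> c * esssup M g"
    using esssup_AE[of g M] by eventually_elim (meson le mult_left_mono order_trans zero_le)
  with top show ?thesis
    by (auto intro: esssup_I)
qed

lemma Lp_norm_mono:
  assumes "0 < p" "f \<in> borel_measurable M" "g \<in> borel_measurable M" "\<And>x. f x \<le> g x"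
  shows "Lp_norm p M f \<le> Lp_norm p M g"
  using Lp_norm_le_mult[of p f M g 1] assms by simp

lemma Lp_norm_cmult:
  assumes "0 < p" "p < top" and [measurable]: "h \<in> borel_measurable M"
  shows "Lp_norm p M (\<lambda>x. c * h x) = c * Lp_norm p M h"
  using assms by (cases p) (auto simp: Lp_norm_ennreal epow_mult nn_integral_cmult)

text \<open>Minkowski in L^(p/q) for the functions h_s^q. Only the ratio p/q >= 1 enters, which
  covers the quasi-normed range below 1.\<close>

lemma Lp_norm_lq_norm_le:
  assumes "0 < q" "q \<le> p" "p < top" and [measurable]: "\<And>s. h s \<in> borel_measurable M"
  shows "Lp_norm p M (\<lambda>x. lq_norm q (\<lambda>s. h s x)) \<le> lq_norm q (\<lambda>s. Lp_norm p M (h s))"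
proof -
  obtain t u where tu: "p = ennreal t" "q = ennreal u" "0 < u" "u \<le> t"
    using assms by (cases p; cases q) (auto simp: top_unique)
  have "epow (\<integral>\<^sup>+x. epow (\<Sum>s. epow (h s x) u) (t / u) \<partial>M) (1 / (t / u))
      \<le> (\<Sum>s. epow (\<integral>\<^sup>+x. epow (epow (h s x) u) (t / u) \<partial>M) (1 / (t / u)))"
    using tu by (intro nn_integral_Minkowski_suminf) auto
  then have "epow (epow (\<integral>\<^sup>+x. epow (\<Sum>s. epow (h s x) u) (t / u) \<partial>M) (1 / (t / u))) (1 / u)
      \<le> epow (\<Sum>s. epow (\<integral>\<^sup>+x. epow (epow (h s x) u) (t / u) \<partial>M) (1 / (t / u))) (1 / u)"
    using tu by (intro epow_mono) auto
  then show ?thesis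
    using tu by (simp add: Lp_norm_ennreal lq_norm_ennreal epow_epow)
qed

text \<open>Minkowski in l^(q/p) for the functions h_s^p; for infinite \<open>q\<close>, each h_s is
  pointwise below the supremum.\<close>

lemma lq_norm_Lp_norm_le:
  assumes "0 < p" "p \<le> q" "p < top" and [measurable]: "\<And>s. h s \<in> borel_measurable M"
  shows "lq_norm q (\<lambda>s. Lp_norm p M (h s)) \<le> Lp_norm p M (\<lambda>x. lq_norm q (\<lambda>s. h s x))"
proof (cases q)
  case top
  show ?thesis
    unfolding top lq_norm_top
    using assms by (intro SUP_least Lp_norm_mono) (auto intro: SUP_upper)
next
  case (real u)
  then obtain t where tu: "p = ennreal t" "0 < t" "t \<le> u"
    using assms by (cases p) auto
  have "epow (\<Sum>s. epow (\<integral>\<^sup>+x. epow (h s x) t \<partial>M) (u / t)) (1 / (u / t))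
      \<le> (\<integral>\<^sup>+x. epow (\<Sum>s. epow (epow (h s x) t) (u / t)) (1 / (u / t)) \<partial>M)"
    using tu by (intro Minkowski_suminf_nn_integral) auto
  then have "epow (epow (\<Sum>s. epow (\<integral>\<^sup>+x. epow (h s x) t \<partial>M) (u / t)) (1 / (u / t))) (1 / t)
      \<le> epow (\<integral>\<^sup>+x. epow (\<Sum>s. epow (epow (h s x) t) (u / t)) (1 / (u / t)) \<partial>M) (1 / t)"
    using tu by (intro epow_mono) auto
  then show ?thesis
    using tu real by (simp add: Lp_norm_ennreal lq_norm_ennreal epow_epow)
qed

section \<open>Measurability of the dyadic blocks\<close>

lemma invariant_unit_vec:
  assumes R: "unitary_dual G K R" and \<xi>: "\<xi> \<in> R" and j: "j < inv_dim G K \<xi>"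
  shows "unit_vec (rep_dim G \<xi>) j \<in> invariant_vecs G K \<xi>"
proof -
  let ?n = "rep_dim G \<xi>"
  let ?S = "{unit_vec ?n i |i. i < inv_dim G K \<xi>}"
  interpret vec_space "TYPE(complex)" ?n .
  have "?S \<subseteq> span ?S"
    by (rule in_own_span) auto
  moreover have "span ?S = invariant_vecs G K \<xi>"
    using R \<xi> unfolding unitary_dual_def by auto
  ultimately show ?thesis
    using j by blast
qed

text \<open>The basis vector e_j is K-invariant, so column j of \<xi>(k) is e_j, and multiplying
  \<xi>(x) by it returns column j of \<xi>(x).\<close>

lemma rep_entry_right_invariant:
  assumes R: "unitary_dual G K R" and \<xi>: "\<xi> \<in> R" and x: "x \<in> carrier G"
    and k: "k \<in> K" "k \<in> carrier G" and ij: "i < rep_dim G \<xi>" "j < rep_dim G \<xi>" "j < inv_dim G K \<xi>"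
  shows "\<xi> (x \<otimes>\<^bsub>G\<^esub> k) $$ (i, j) = \<xi> x $$ (i, j)"
proof -
  let ?n = "rep_dim G \<xi>"
  have U: "unitary_rep G \<xi>"
    using R \<xi> unfolding unitary_dual_def irreducible_rep_def by auto
  then have C: "\<xi> x \<in> carrier_mat ?n ?n" "\<xi> k \<in> carrier_mat ?n ?n"
    and xk: "\<xi> (x \<otimes>\<^bsub>G\<^esub> k) = \<xi> x * \<xi> k"
    using x k unfolding unitary_rep_def by auto
  have "\<xi> k *\<^sub>v unit_vec ?n j = unit_vec ?n j"
    using invariant_unit_vec[OF R \<xi> ij(3)] k by (auto simp: invariant_vecs_def)
  moreover have "\<xi> k *\<^sub>v unit_vec ?n j = col (\<xi> k) j"
    using C ij by (intro eq_vecI) auto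
  ultimately have "col (\<xi> k) j = unit_vec ?n j"
    by simp
  with C ij show ?thesis
    by (simp add: xk)
qed

text \<open>The representative picked by \<open>SOME\<close> has the form xk with k in K, where
  \<open>h\<close> has the same value.\<close>

lemma descend_coset_of:
  assumes "group G" "subgroup (stab G) G" "x \<in> carrier G"
    and inv: "\<And>k. k \<in> stab G \<Longrightarrow> h (x \<otimes>\<^bsub>G\<^esub> k) = h x"
  shows "descend G h (coset_of G x) = h x"
proof -
  interpret group G by fact
  have "coset_of G x \<in> cosets G"
    using assms by (auto simp: LCOSETS_def)
  moreover have "x \<in> coset_of G x"
    using assms(2,3) subgroup.one_closed[of "stab G" G] by (force simp: l_coset_def)
  then have "(SOME y. y \<in> coset_of G x) \<in> coset_of G x"
    by (rule someI)
  then have "h (SOME y. y \<in> coset_of G x) = h x"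
    using inv by (auto simp: l_coset_def)
  ultimately show ?thesis
    by (simp add: descend_def)
qed

text \<open>The preimage of an open set under the descended function pulls back to its preimage
  under \<open>h\<close>, which is open in G; hence it is a generator of
  \<open>coset_borel\<close>.\<close>

lemma measurable_descend:
  assumes G: "group G" "subgroup (stab G) G" "topspace (lie_top G) = carrier G"
    and cont: "continuous_map (lie_top G) euclidean h"
    and inv: "\<And>x k. x \<in> carrier G \<Longrightarrow> k \<in> stab G \<Longrightarrow> h (x \<otimes>\<^bsub>G\<^esub> k) = h x"
  shows "descend G h \<in> borel_measurable (coset_measure G)"
proof -
  let ?\<Sigma> = "{S. S \<subseteq> cosets G \<and> openin (lie_top G) {g \<in> carrier G. coset_of G g \<in> S}}"
  have "descend G h \<in> borel_measurable (coset_borel G)"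
  proof (rule borel_measurableI)
    fix S :: "complex set"
    assume "open S"
    have "coset_of G g \<in> cosets G" if "g \<in> carrier G" for g
      using that by (auto simp: LCOSETS_def)
    then have "{g \<in> carrier G. coset_of G g \<in> descend G h -` S \<inter> cosets G} =
        {g \<in> topspace (lie_top G). h g \<in> S}"
      using G inv by (auto simp: descend_coset_of)
    moreover have "openin (lie_top G) {g \<in> topspace (lie_top G). h g \<in> S}"
      using cont \<open>open S\<close> by (intro openin_continuous_map_preimage) auto
    ultimately have "descend G h -` S \<inter> cosets G \<in> ?\<Sigma>"
      by auto
    moreover have "?\<Sigma> \<subseteq> Pow (cosets G)"
      by auto
    ultimately show "descend G h -` S \<inter> space (coset_borel G) \<in> sets (coset_borel G)"
      unfolding coset_borel_def by (simp add: space_measure_of sigma_sets.Basic)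
  qed
  then show ?thesis
    unfolding coset_measure_def by simp
qed

text \<open>In the trace the row index of the coefficient is the column index of \<xi>, so the
  truncation retains exactly the right K-invariant entries.\<close>

lemma mat_trace_fourier_coeff_truncated:
  "mat_trace (fourier_coeff G f \<xi> * truncated G \<xi> x) =
    (\<Sum>i<rep_dim G \<xi>. \<Sum>k<rep_dim G \<xi>. fourier_coeff G f \<xi> $$ (i, k) *
      (if i < inv_dim G (stab G) \<xi> then \<xi> x $$ (k, i) else 0))"
  unfolding mat_trace_def
  by (auto simp: fourier_coeff_def truncated_def scalar_prod_def lessThan_atLeast0 intro!: sum.cong)

lemma continuous_map_cmult:
  fixes f :: "'b \<Rightarrow> complex"
  assumes "continuous_map X euclidean f"
  shows "continuous_map X euclidean (\<lambda>x. c * f x)"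
proof -
  have "continuous_map euclidean euclidean ((*) c)"
    by (auto intro!: continuous_intros)
  with assms show ?thesis
    using continuous_map_compose[of X euclidean f euclidean "(*) c"] by (simp add: o_def)
qed

lemma measurable_dyadic_block:
  assumes "compact_homogeneous_space G"
  shows "dyadic_block G f s \<in> borel_measurable (coset_measure G)"
proof -
  have G: "group G" "subgroup (stab G) G" "topspace (lie_top G) = carrier G"
    and R: "unitary_dual G (stab G) (dual G)"
    using assms by (auto simp: compact_homogeneous_space_def compact_lie_group_def)
  have K: "k \<in> carrier G" if "k \<in> stab G" for k
    using subgroup.mem_carrier[OF G(2) that] .
  have cont: "continuous_map (lie_top G) euclidean (\<lambda>x. \<xi> x $$ (i, j))"
    if "\<xi> \<in> class_I G" "i < rep_dim G \<xi>" "j < rep_dim G \<xi>" for \<xi> i j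
    using that R by (auto simp: class_I_def unitary_dual_def irreducible_rep_def unitary_rep_def)
  have inv: "\<xi> (x \<otimes>\<^bsub>G\<^esub> k) $$ (i, j) = \<xi> x $$ (i, j)"
    if "\<xi> \<in> class_I G" "i < rep_dim G \<xi>" "j < rep_dim G \<xi>" "j < inv_dim G (stab G) \<xi>"
      "x \<in> carrier G" "k \<in> stab G" for \<xi> i j x k
    using that K by (intro rep_entry_right_invariant[OF R]) (auto simp: class_I_def)
  let ?I = "{\<xi>. \<xi> \<in> class_I G \<and> 2 ^ s \<le> weight G \<xi> \<and> weight G \<xi> < 2 ^ (s + 1)}"
  show ?thesis
    unfolding dyadic_block_def mat_trace_fourier_coeff_truncated
  proof (rule measurable_descend[OF G])
    have "continuous_map (lie_top G) euclidean (\<lambda>x. of_nat (rep_dim G \<xi>) *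
        (\<Sum>i<rep_dim G \<xi>. \<Sum>k<rep_dim G \<xi>. fourier_coeff G f \<xi> $$ (i, k) *
          (if i < inv_dim G (stab G) \<xi> then \<xi> x $$ (k, i) else 0)))"
      if "\<xi> \<in> class_I G" for \<xi>
      using cont[OF that]
      by (intro continuous_map_cmult continuous_map_sum) (auto intro!: continuous_map_cmult)
    then show "continuous_map (lie_top G) euclidean (\<lambda>x. \<Sum>\<xi>\<in>?I. of_nat (rep_dim G \<xi>) *
        (\<Sum>i<rep_dim G \<xi>. \<Sum>k<rep_dim G \<xi>. fourier_coeff G f \<xi> $$ (i, k) *
          (if i < inv_dim G (stab G) \<xi> then \<xi> x $$ (k, i) else 0)))"
      \<comment> \<open>Over an infinite index set the sum is 0 by convention, which is continuous
        as well.\<close>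
      by (cases "finite ?I") (auto intro!: continuous_map_sum)
  qed (auto intro!: sum.cong simp: inv)
qed

section \<open>Embeddings\<close>

lemma triebel_lizorkin_norm_eq:
  "triebel_lizorkin_norm G r p q f = Lp_norm p (coset_measure G)
    (\<lambda>x. lq_norm q (\<lambda>s. ennreal (2 powr (real s * r)) * ennreal (cmod (dyadic_block G f s x))))"
  by (simp add: triebel_lizorkin_norm_def weighted_lq_norm_eq_lq_norm)

text \<open>Moving the weight inside L^p makes the Besov norm a mixed norm of the same functions as
  in \<open>triebel_lizorkin_norm_eq\<close>.\<close>

lemma besov_norm_eq:
  assumes "compact_homogeneous_space G" "0 < p" "p < top"
  shows "besov_norm G r p q f = lq_norm q (\<lambda>s. Lp_norm p (coset_measure G)
    (\<lambda>x. ennreal (2 powr (real s * r)) * ennreal (cmod (dyadic_block G f s x))))"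
  using assms measurable_dyadic_block[OF assms(1)]
  by (simp add: besov_norm_def weighted_lq_norm_eq_lq_norm Lp_norm_cmult)

text \<open>Both spaces are cut out of the same \<open>D\<close> by finiteness of the norm, so one
  inequality for all \<open>f\<close> yields inclusion and boundedness.\<close>

lemma embeds_distributionsI:
  assumes "\<And>f. snd W f \<le> ennreal c * snd V f"
    and "fst V = {f \<in> D. snd V f < \<infinity>}" "fst W = {f \<in> D. snd W f < \<infinity>}"
  shows "V \<hookrightarrow> W"
proof -
  have "snd W f < \<infinity>" if "snd V f < \<infinity>" for f
    using that by (intro le_less_trans[OF assms(1)]) (auto simp: ennreal_mult_less_top)
  then show ?thesis
    using assms unfolding embeds_def by auto
qed

lemma triebel_lizorkin_embeds:
  assumes G: "compact_homogeneous_space G" and p: "0 < p"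
    and le: "\<And>a. weighted_lq_norm r' q' a \<le> ennreal c * weighted_lq_norm r q a"
  shows "triebel_lizorkin G r p q \<hookrightarrow> triebel_lizorkin G r' p q'"
proof (rule embeds_distributionsI[where D = "distributions G" and c = c])
  note [measurable] = measurable_dyadic_block[OF G]
  show "snd (triebel_lizorkin G r' p q') f \<le> ennreal c * snd (triebel_lizorkin G r p q) f" for f
    using le p unfolding triebel_lizorkin_def snd_conv triebel_lizorkin_norm_eq
      weighted_lq_norm_eq_lq_norm
    by (intro Lp_norm_le_mult) auto
qed (auto simp: triebel_lizorkin_def)

text \<open>Since \<open>s\<close> starts at 0, every weight 2^(sr) increases with \<open>r\<close>,
  and the constant is 1.\<close>

lemma weighted_lq_norm_mono_weight:
  assumes "0 < q" "r \<le> r'"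
  shows "weighted_lq_norm r q a \<le> weighted_lq_norm r' q a"
  unfolding weighted_lq_norm_eq_lq_norm
proof (intro lq_norm_mono mult_right_mono ennreal_leI)
  show "2 powr (real s * r) \<le> 2 powr (real s * r')" for s
    using assms by (intro powr_mono mult_left_mono) auto
qed (use assms in auto)

text \<open>The estimate passes through the supremum with weight r + \<epsilon>, which lies below
  every l^q' norm; \<open>q\<close> and \<open>q'\<close> may come in either order.\<close>

lemma weighted_lq_norm_decay:
  assumes "0 < q" "q < top" "0 < q'" "0 < \<epsilon>"
  obtains c where "\<And>a. weighted_lq_norm r q a \<le> ennreal c * weighted_lq_norm (r + \<epsilon>) q' a"
proof -
  obtain c where c: "lq_norm q b \<le> ennreal c * (SUP s. ennreal (2 powr (real s * \<epsilon>)) * b s)" for b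
    using lq_norm_le_SUP_weighted[of q \<epsilon>] assms by blast
  have "weighted_lq_norm r q a \<le> ennreal c * weighted_lq_norm (r + \<epsilon>) q' a" for a
  proof -
    have "weighted_lq_norm r q a \<le> ennreal c *
        (SUP s. ennreal (2 powr (real s * \<epsilon>)) * (ennreal (2 powr (real s * r)) * a s))"
      unfolding weighted_lq_norm_eq_lq_norm by (rule c)
    also have "\<dots> = ennreal c * (SUP s. ennreal (2 powr (real s * (r + \<epsilon>))) * a s)"
      by (simp add: algebra_simps powr_add ennreal_mult)
    also have "\<dots> \<le> ennreal c * weighted_lq_norm (r + \<epsilon>) q' a"
      unfolding weighted_lq_norm_eq_lq_norm
      using assms by (intro mult_left_mono SUP_least le_lq_norm[where b = "\<lambda>s. _ s * a s"]) auto
    finally show ?thesis .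
  qed
  then show thesis by (rule that)
qed

lemma besov_embeds_triebel_lizorkin:
  assumes G: "compact_homogeneous_space G" and "0 < q" "q \<le> p" "p < top"
  shows "besov G r p q \<hookrightarrow> triebel_lizorkin G r p q"
proof (rule embeds_distributionsI[where D = "distributions G" and c = 1])
  note [measurable] = measurable_dyadic_block[OF G]
  show "snd (triebel_lizorkin G r p q) f \<le> ennreal 1 * snd (besov G r p q) f" for f
    unfolding triebel_lizorkin_def besov_def snd_conv triebel_lizorkin_norm_eq ennreal_1 mult_1
      besov_norm_eq[OF G less_le_trans[OF assms(2,3)] assms(4)]
    by (intro Lp_norm_lq_norm_le[OF assms(2-4)]) measurable
qed (auto simp: triebel_lizorkin_def besov_def)

lemma triebel_lizorkin_embeds_besov:
  assumes G: "compact_homogeneous_space G" and "0 < p" "p \<le> q" "p < top"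
  shows "triebel_lizorkin G r p q \<hookrightarrow> besov G r p q"
proof (rule embeds_distributionsI[where D = "distributions G" and c = 1])
  note [measurable] = measurable_dyadic_block[OF G]
  show "snd (besov G r p q) f \<le> ennreal 1 * snd (triebel_lizorkin G r p q) f" for f
    unfolding triebel_lizorkin_def besov_def snd_conv triebel_lizorkin_norm_eq ennreal_1 mult_1
      besov_norm_eq[OF G assms(2) assms(4)]
    by (intro lq_norm_Lp_norm_le[OF assms(2-4)]) measurable
qed (auto simp: triebel_lizorkin_def besov_def)

lemma embeds_trans: "U \<hookrightarrow> V \<Longrightarrow> V \<hookrightarrow> W \<Longrightarrow> U \<hookrightarrow> W"
  unfolding embeds_def
proof safe
  fix c d :: real
  assume "fst U \<subseteq> fst V" and c: "\<forall>f\<in>fst U. snd V f \<le> ennreal c * snd U f"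
    and d: "\<forall>f\<in>fst V. snd W f \<le> ennreal d * snd V f"
  \<comment> \<open>Constants in \<open>embeds\<close> may be negative and then count as 0 under
    \<open>ennreal\<close>; truncating them first makes \<open>ennreal\<close>
    multiplicative.\<close>
  have "snd W f \<le> ennreal (max 0 d * max 0 c) * snd U f" if "f \<in> fst U" for f
  proof -
    have "snd W f \<le> ennreal d * (ennreal c * snd U f)"
      using that c d \<open>fst U \<subseteq> fst V\<close> by (meson mult_left_mono order_trans subsetD zero_le)
    moreover have "ennreal (max 0 z) = ennreal z" for z
      by (cases "0 \<le> z") (auto simp: ennreal_neg)
    ultimately show ?thesis
      by (simp add: ennreal_mult mult.assoc)
  qed
  then show "\<exists>c::real. \<forall>f\<in>fst U. snd W f \<le> ennreal c * snd U f"
    by blast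
qed blast

theorem theorem5p3:
  fixes G :: "'a homogeneous_space" and n :: nat and r :: real
  assumes "compact_homogeneous_space G"
    and "homogeneous_dim G = n"
  shows
    "(\<forall>\<epsilon>>0. \<forall>p>0. \<forall>q1>0. \<forall>q2\<ge>q1.
        triebel_lizorkin G (r + \<epsilon>) p q1 \<hookrightarrow> triebel_lizorkin G r p q1 \<and>
        triebel_lizorkin G r p q1 \<hookrightarrow> triebel_lizorkin G r p q2 \<and>
        triebel_lizorkin G r p q2 \<hookrightarrow> triebel_lizorkin G r p \<infinity>) \<and>
     (\<forall>\<epsilon>>0. \<forall>p>0. \<forall>q1 q2. 1 \<le> q2 \<and> q2 < q1 \<and> q1 < \<infinity> \<longrightarrow>
        triebel_lizorkin G (r + \<epsilon>) p q1 \<hookrightarrow> triebel_lizorkin G r p q2) \<and>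
     (\<forall>p. 0 < p \<and> p < \<infinity> \<longrightarrow> triebel_lizorkin G r p p \<cong>\<^sub>s besov G r p p) \<and>
     (\<forall>p q. 0 < p \<and> p < \<infinity> \<and> 0 < q \<longrightarrow>
        besov G r p (min p q) \<hookrightarrow> triebel_lizorkin G r p q \<and>
        triebel_lizorkin G r p q \<hookrightarrow> besov G r p (max p q))"
proof -
  note G = assms(1)
  have smoothness: "triebel_lizorkin G (r + \<epsilon>) p q \<hookrightarrow> triebel_lizorkin G r p q"
    if "0 < \<epsilon>" "0 < p" "0 < q" for \<epsilon> p q
    using that weighted_lq_norm_mono_weight[of q r "r + \<epsilon>"]
    by (intro triebel_lizorkin_embeds[OF G, where c = 1]) auto
  have fine: "triebel_lizorkin G r p q1 \<hookrightarrow> triebel_lizorkin G r p q2"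
    if "0 < p" "0 < q1" "q1 \<le> q2" for p q1 q2
    using that by (intro triebel_lizorkin_embeds[OF G, where c = 1])
      (auto simp: weighted_lq_norm_eq_lq_norm intro: lq_norm_antimono)
  have tradeoff: "triebel_lizorkin G (r + \<epsilon>) p q1 \<hookrightarrow> triebel_lizorkin G r p q2"
    if "0 < \<epsilon>" "0 < p" "0 < q1" "0 < q2" "q2 < top" for \<epsilon> p q1 q2
    using weighted_lq_norm_decay[of q2 q1 \<epsilon> r] that triebel_lizorkin_embeds[OF G] by metis
  have diag: "triebel_lizorkin G r p p \<hookrightarrow> besov G r p p" "besov G r p p \<hookrightarrow> triebel_lizorkin G r p p"
    if "0 < p" "p < top" for p
    using that besov_embeds_triebel_lizorkin[OF G] triebel_lizorkin_embeds_besov[OF G] by auto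
  \<comment> \<open>Minkowski acts at second index \<open>min p q\<close>, which is at most
    \<open>p\<close>; then \<open>fine\<close> raises the index to \<open>q\<close>.\<close>
  have lower: "besov G r p (min p q) \<hookrightarrow> triebel_lizorkin G r p q" if "0 < p" "p < top" "0 < q" for p q
  proof (rule embeds_trans)
    show "besov G r p (min p q) \<hookrightarrow> triebel_lizorkin G r p (min p q)"
      using that by (intro besov_embeds_triebel_lizorkin[OF G]) auto
  qed (use that in \<open>auto intro: fine\<close>)
  \<comment> \<open>Here \<open>fine\<close> first raises the index to \<open>max p q\<close>, which
    is at least \<open>p\<close>, as the reverse Minkowski step requires.\<close>
  have upper: "triebel_lizorkin G r p q \<hookrightarrow> besov G r p (max p q)" if "0 < p" "p < top" "0 < q" for p q
  proof (rule embeds_trans)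
    show "triebel_lizorkin G r p (max p q) \<hookrightarrow> besov G r p (max p q)"
      using that by (intro triebel_lizorkin_embeds_besov[OF G]) auto
  qed (use that in \<open>auto intro: fine\<close>)
  have same: "triebel_lizorkin G r p p \<cong>\<^sub>s besov G r p p" if "0 < p" "p < top" for p
    using diag[OF that] by (auto simp: same_space_def embeds_def)
  show ?thesis
  proof (intro conjI allI impI)
    fix p q1 q2 :: ennreal
    assume "0 < p" "0 < q1" "q1 \<le> q2"
    then show "triebel_lizorkin G r p q1 \<hookrightarrow> triebel_lizorkin G r p q2"
      "triebel_lizorkin G r p q2 \<hookrightarrow> triebel_lizorkin G r p \<infinity>"
      by (auto intro!: fine intro: less_le_trans)
  next
    fix \<epsilon> :: real and p q1 q2 :: ennreal
    assume "0 < \<epsilon>" "0 < p" and q: "1 \<le> q2 \<and> q2 < q1 \<and> q1 < \<infinity>"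
    moreover have "0 < q2"
      using q by (auto intro: less_le_trans[of 0 1])
    ultimately show "triebel_lizorkin G (r + \<epsilon>) p q1 \<hookrightarrow> triebel_lizorkin G r p q2"
      by (auto intro!: tradeoff intro: less_trans)
  qed (auto simp: smoothness same lower upper)
qed

end
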